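(* Let $m\ge 1$ and $k\ge 2$ be integers. Then there exist (linearly) $k$-regular continuous maps $\mathbb{R}^m \to \mathbb{R}^{(m+1)(k-1)}$ and $\mathbb{C}^m \to \mathbb{C}^{(m+1)(k-1)}$.
   Context: For $\mathbb{F}\in\{\mathbb{R},\mathbb{C}\}$, a continuous map $f\colon \mathbb{F}^m\to\mathbb{F}^N$ is called (linearly) $k$-regular if for any $k$ pairwise distinct points $p_1,\dots,p_k\in\mathbb{F}^m$ the vectors $f(p_1),\dots,f(p_k)$ are linearly independent over $\mathbb{F}$ (i.e. span a $k$-dimensional linear subspace). *)

theory Defs
  imports "HOL-Analysis.Analysis"
begin

text \<open>Linear k-regularity over the reals: any k pairwise distinct points are mapped
  to k linearly independent vectors (injectivity on the set ensures the k images
  are distinct, so they span a k-dimensional subspace).\<close>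
definition k_regular_real :: "nat \<Rightarrow> (real^'m \<Rightarrow> real^'n) \<Rightarrow> bool" where
  "k_regular_real k f \<longleftrightarrow>
     (\<forall>S. finite S \<and> card S = k \<longrightarrow> inj_on f S \<and> vec.independent (f ` S))"

definition k_regular_complex :: "nat \<Rightarrow> (complex^'m \<Rightarrow> complex^'n) \<Rightarrow> bool" where
  "k_regular_complex k f \<longleftrightarrow>
     (\<forall>S. finite S \<and> card S = k \<longrightarrow> inj_on f S \<and> vec.independent (f ` S))"

end

theory Submission
  imports Defs "HOL-Library.Function_Algebras"
begin

text \<open>The map is \<open>f \<circ> h\<close> for a generic polynomial map \<open>f\<close> and an injection \<open>h\<close> of the whole space into a
  small ball.  Suppose that \<open>\<Sum>\<^sub>i u\<^sub>i f(p\<^sub>i) = 0\<close> with \<open>u\<^sub>0 = 1\<close>, and let \<open>\<epsilon>\<close> be a nonzero coordinate of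
  \<open>p\<^sub>1 - p\<^sub>0\<close>.  With \<open>N = (m + 1)(k - 1)\<close> components, such data
  have \<open>km + (k - 1) - N = m\<close> degrees of freedom more than \<open>f\<close> itself, whereas the triples
  \<open>(f, p\<^sub>0, \<epsilon>)\<close> have \<open>m + 1\<close> more.  Hence a nonzero polynomial \<open>F(f, p\<^sub>0, \<epsilon>)\<close> vanishes on all triples that come from
  a dependency.  Dividing \<open>F\<close> by a power of \<open>\<epsilon>\<close>, one may assume that \<open>F(f, p\<^sub>0, 0)\<close> is not identically zero.
  If it does not vanish at \<open>(f, q)\<close>, then \<open>f\<close> is \<open>k\<close>-regular on a small ball around \<open>q\<close>, since there \<open>p\<^sub>0\<close> is
  close to \<open>q\<close> and \<open>\<epsilon>\<close> is nonzero but small.\<close>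

subsection \<open>Algebraic dependence of rational functions\<close>

interpretation funs: vector_space "\<lambda>(c::'a::field) (f::'b \<Rightarrow> 'a) x. c * f x"
  by unfold_locales (auto simp: fun_eq_iff algebra_simps)

lemma sum_fun_apply: "(\<Sum>i\<in>A. f i) x = (\<Sum>i\<in>A. f i x)" for f :: "'i \<Rightarrow> 'b \<Rightarrow> 'a::comm_monoid_add"
  by (induction A rule: infinite_finite_induct) auto

text \<open>The family \<open>R\<close> may repeat. Two equal members give the relation with
  coefficients 1 and -1; without repetitions the image has more elements than the spanning set
  \<open>B\<close>, hence is dependent.\<close>

lemma exists_linear_relation:
  fixes R :: "'i \<Rightarrow> 'b \<Rightarrow> 'a::field"
  assumes "finite A" "finite B" "card B < card A" and R: "\<And>i. i \<in> A \<Longrightarrow> R i \<in> funs.span B"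
  shows "\<exists>c. (\<exists>i\<in>A. c i \<noteq> 0) \<and> (\<forall>x. (\<Sum>i\<in>A. c i * R i x) = 0)"
proof (cases "inj_on R A")
  case True
  then have "card (R ` A) > card B"
    using assms by (simp add: card_image)
  then have "\<not> funs.independent (R ` A)"
    using funs.independent_span_bound[of B "R ` A"] assms by auto
  then obtain u where u: "\<exists>v\<in>R ` A. u v \<noteq> 0" "(\<Sum>v\<in>R ` A. (\<lambda>x. u v * v x)) = 0"
    using funs.dependent_finite[of "R ` A"] \<open>finite A\<close> by auto
  have "(\<Sum>i\<in>A. u (R i) * R i x) = 0" for x
  proof -
    have "(\<Sum>i\<in>A. u (R i) * R i x) = (\<Sum>v\<in>R ` A. (\<lambda>x. u v * v x)) x"
      unfolding sum_fun_apply sum.reindex[OF True] by simp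
    then show ?thesis using u(2) by simp
  qed
  then show ?thesis
    using u(1) by (intro exI[of _ "u \<circ> R"]) auto
next
  case False
  then obtain i j where ij: "i \<in> A" "j \<in> A" "i \<noteq> j" "R i = R j"
    by (auto simp: inj_on_def)
  have "(\<Sum>l\<in>A. (if l = i then 1 else if l = j then - 1 else 0) * R l x) = 0" for x
  proof -
    have "(\<Sum>l\<in>A. (if l = i then 1 else if l = j then - 1 else 0) * R l x)
        = (\<Sum>l\<in>A. (if l = i then R i x else 0) + (if l = j then - R j x else 0))"
      using ij by (intro sum.cong) auto
    then show ?thesis
      using ij \<open>finite A\<close> by (simp add: sum.distrib)
  qed
  then show ?thesis
    using ij by (intro exI[of _ "\<lambda>l. if l = i then 1 else if l = j then - 1 else 0"]) auto
qed

section \<open>Polynomial functions of bounded degree\<close>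

definition monomial :: "'i set \<Rightarrow> ('i \<Rightarrow> nat) \<Rightarrow> ('i \<Rightarrow> 'a) \<Rightarrow> 'a::comm_monoid_mult" where
  "monomial I \<alpha> y = (\<Prod>i\<in>I. y i ^ \<alpha> i)"

text \<open>The bound \<open>L\<close> applies to each exponent separately, not to the total degree.
  Extensionality outside \<open>I\<close> makes the set countable by a product formula.\<close>

definition exponents :: "'i set \<Rightarrow> nat \<Rightarrow> ('i \<Rightarrow> nat) set" where
  "exponents I L = I \<rightarrow>\<^sub>E {..L}"

definition poly_funs :: "'i set \<Rightarrow> nat \<Rightarrow> (('i \<Rightarrow> 'a) \<Rightarrow> 'a::field) set" where
  "poly_funs I L = funs.span (monomial I ` exponents I L)"

lemma finite_exponents [simp]: "finite I \<Longrightarrow> finite (exponents I L)"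
  by (simp add: exponents_def finite_PiE)

lemma card_exponents: "finite I \<Longrightarrow> card (exponents I L) = (L + 1) ^ card I"
  by (simp add: exponents_def card_PiE)

lemma monomial_in_poly_funs:
  assumes "\<And>i. i \<in> I \<Longrightarrow> \<alpha> i \<le> L"
  shows "monomial I \<alpha> \<in> poly_funs I L"
proof -
  have "monomial I \<alpha> = monomial I (restrict \<alpha> I)"
    by (auto simp: monomial_def fun_eq_iff intro!: prod.cong)
  moreover have "restrict \<alpha> I \<in> exponents I L"
    using assms by (auto simp: exponents_def)
  ultimately show ?thesis
    by (auto simp: poly_funs_def intro: funs.span_base)
qed

lemma poly_funs_add:
  "f \<in> poly_funs I L \<Longrightarrow> g \<in> poly_funs I L \<Longrightarrow> (\<lambda>y. f y + g y) \<in> poly_funs I L"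
  using funs.span_add[of f _ g] by (simp add: poly_funs_def plus_fun_def)

lemma poly_funs_scale: "f \<in> poly_funs I L \<Longrightarrow> (\<lambda>y. c * f y) \<in> poly_funs I L"
  using funs.span_scale by (simp add: poly_funs_def)

lemma poly_funs_mono: "L \<le> L' \<Longrightarrow> poly_funs I L \<subseteq> poly_funs I L'"
  unfolding poly_funs_def by (intro funs.span_mono image_mono) (auto simp: exponents_def PiE_def Pi_def)

lemma poly_funs_const: "(\<lambda>y. c) \<in> poly_funs I L"
  using poly_funs_scale[OF monomial_in_poly_funs[of I "\<lambda>_. 0" L], of c] by (simp add: monomial_def)

lemma poly_funs_var:
  assumes "finite I" "i \<in> I"
  shows "(\<lambda>y. y i :: 'a::field) \<in> poly_funs I 1"
proof -
  have "monomial I (\<lambda>j. if j = i then 1 else 0) = (\<lambda>y. y i :: 'a)"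
    using assms by (simp add: monomial_def fun_eq_iff if_distrib [where f = "power _"] prod.delta cong: if_cong)
  moreover have "(monomial I (\<lambda>j. if j = i then 1 else 0) :: _ \<Rightarrow> 'a) \<in> poly_funs I 1"
    by (rule monomial_in_poly_funs) auto
  ultimately show ?thesis by simp
qed

lemma poly_funs_induct [consumes 1, case_names zero add]:
  assumes "f \<in> poly_funs I L" "P (\<lambda>y. 0)"
    and "\<And>c \<alpha> g. \<alpha> \<in> exponents I L \<Longrightarrow> P g \<Longrightarrow> P (\<lambda>y. c * monomial I \<alpha> y + g y)"
  shows "P f"
  using assms(1) unfolding poly_funs_def
proof (induction rule: funs.span_induct_alt)
  case base
  then show ?case using assms(2) by (simp add: zero_fun_def)
next
  case (step c x y)
  then show ?case using assms(3) by (auto simp: plus_fun_def)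
qed

lemma poly_funs_mult:
  assumes f: "f \<in> poly_funs I L" and g: "g \<in> poly_funs I L'"
  shows "(\<lambda>y. f y * g y) \<in> poly_funs I (L + L')"
  using f
proof (induction rule: poly_funs_induct)
  case zero
  then show ?case using poly_funs_const[of 0] by simp
next
  case (add c \<alpha> f)
  have "(\<lambda>y. monomial I \<alpha> y * g y) \<in> poly_funs I (L + L')"
    using g
  proof (induction rule: poly_funs_induct)
    case zero
    then show ?case using poly_funs_const[of 0] by simp
  next
    case (add d \<beta> h)
    have "(\<lambda>y. monomial I \<alpha> y * (d * monomial I \<beta> y + h y))
        = (\<lambda>y. d * monomial I (\<lambda>i. \<alpha> i + \<beta> i) y + monomial I \<alpha> y * h y)"
      by (simp add: monomial_def fun_eq_iff algebra_simps power_add prod.distrib)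
    moreover have "monomial I (\<lambda>i. \<alpha> i + \<beta> i) \<in> poly_funs I (L + L')"
      using \<open>\<alpha> \<in> _\<close> \<open>\<beta> \<in> _\<close>
      by (intro monomial_in_poly_funs add_mono) (auto simp: exponents_def PiE_def Pi_def)
    ultimately show ?case
      using poly_funs_add[OF poly_funs_scale add.IH] by simp
  qed
  then show ?case
    using poly_funs_add[OF poly_funs_scale add.IH, of "\<lambda>y. monomial I \<alpha> y * g y" c]
    by (simp add: algebra_simps)
qed

lemma poly_funs_power: "f \<in> poly_funs I L \<Longrightarrow> (\<lambda>y. f y ^ n) \<in> poly_funs I (n * L)"
proof (induction n)
  case (Suc n)
  then show ?case using poly_funs_mult[of f I L "\<lambda>y. f y ^ n" "n * L"] by simp
qed (simp add: poly_funs_const)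

lemma poly_funs_prod:
  assumes "\<And>a. a \<in> A \<Longrightarrow> f a \<in> poly_funs I (L a)"
  shows "(\<lambda>y. \<Prod>a\<in>A. f a y) \<in> poly_funs I (\<Sum>a\<in>A. L a)"
  using assms
  by (induction A rule: infinite_finite_induct)
    (auto simp: poly_funs_const intro!: poly_funs_mult)

definition polynomial_on :: "'i set \<Rightarrow> (('i \<Rightarrow> 'a) \<Rightarrow> 'a::field) \<Rightarrow> bool" where
  "polynomial_on I f \<longleftrightarrow> (\<exists>L. f \<in> poly_funs I L)"

lemma polynomial_on_const: "polynomial_on I (\<lambda>y. c)"
  using poly_funs_const by (auto simp: polynomial_on_def)

lemma polynomial_on_var: "finite I \<Longrightarrow> i \<in> I \<Longrightarrow> polynomial_on I (\<lambda>y. y i)"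
  unfolding polynomial_on_def by (blast intro: poly_funs_var)

lemma polynomial_on_add:
  assumes "polynomial_on I f" "polynomial_on I g" 
  shows "polynomial_on I (\<lambda>y. f y + g y)"
proof -
  from assms obtain L L' where "f \<in> poly_funs I L" "g \<in> poly_funs I L'"
    by (auto simp: polynomial_on_def)
  then have "f \<in> poly_funs I (max L L')" "g \<in> poly_funs I (max L L')"
    using poly_funs_mono[of L "max L L'"] poly_funs_mono[of L' "max L L'"] by auto
  then show ?thesis
    unfolding polynomial_on_def by (blast intro: poly_funs_add)
qed

lemma polynomial_on_mult:
  "polynomial_on I f \<Longrightarrow> polynomial_on I g \<Longrightarrow> polynomial_on I (\<lambda>y. f y * g y)"
  using poly_funs_mult by (fastforce simp: polynomial_on_def)

lemma polynomial_on_uminus: "polynomial_on I f \<Longrightarrow> polynomial_on I (\<lambda>y. - f y)"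
  using polynomial_on_mult[OF polynomial_on_const[of I "-1"]] by fastforce

lemma polynomial_on_diff:
  "polynomial_on I f \<Longrightarrow> polynomial_on I g \<Longrightarrow> polynomial_on I (\<lambda>y. f y - g y)"
  using polynomial_on_add[OF _ polynomial_on_uminus] by fastforce

lemma polynomial_on_sum:
  "(\<And>a. a \<in> A \<Longrightarrow> polynomial_on I (f a)) \<Longrightarrow> polynomial_on I (\<lambda>y. \<Sum>a\<in>A. f a y)"
  by (induction A rule: infinite_finite_induct)
    (auto simp: polynomial_on_const intro!: polynomial_on_add)

lemma polynomial_on_power: "polynomial_on I f \<Longrightarrow> polynomial_on I (\<lambda>y. f y ^ n)"
  using poly_funs_power by (fastforce simp: polynomial_on_def)

lemma polynomial_on_prod:
  "(\<And>a. a \<in> A \<Longrightarrow> polynomial_on I (f a)) \<Longrightarrow> polynomial_on I (\<lambda>y. \<Prod>a\<in>A. f a y)"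
  by (induction A rule: infinite_finite_induct)
    (auto simp: polynomial_on_const intro!: polynomial_on_mult)

lemma polynomial_on_common_degree:
  assumes "finite A" "\<And>a. a \<in> A \<Longrightarrow> polynomial_on I (f a)"
  shows "\<exists>L. \<forall>a\<in>A. f a \<in> poly_funs I L"
proof -
  obtain L where L: "f a \<in> poly_funs I (L a)" if "a \<in> A" for a
    using assms(2) unfolding polynomial_on_def by metis
  have "f a \<in> poly_funs I (Max (L ` A))" if "a \<in> A" for a
    using L[OF that] poly_funs_mono[of "L a" "Max (L ` A)"] that \<open>finite A\<close> by auto
  then show ?thesis by blast
qed

text \<open>The quotients \<open>G j / Q\<close> outnumber the variables, so they are algebraically
  dependent. The proof counts: after multiplication by \<open>Q ^ (card J * n)\<close>, the
  \<open>(n + 1) ^ card J\<close> monomials in the quotients lie in a space spanned by at most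
  \<open>(e + 1) ^ card I\<close> monomials, which is a smaller number for suitable
  \<open>n\<close>.\<close>

lemma exists_algebraic_relation:
  fixes Q :: "('i \<Rightarrow> 'a::field) \<Rightarrow> 'a" and G :: "'j \<Rightarrow> ('i \<Rightarrow> 'a) \<Rightarrow> 'a"
  assumes "finite I" "finite J" "card I < card J"
    and "polynomial_on I Q" "\<And>j. j \<in> J \<Longrightarrow> polynomial_on I (G j)"
  shows "\<exists>n c. (\<exists>\<alpha>\<in>exponents J n. c \<alpha> \<noteq> 0) \<and>
    (\<forall>y z. Q y \<noteq> 0 \<longrightarrow> (\<forall>j\<in>J. Q y * z j = G j y) \<longrightarrow>
       (\<Sum>\<alpha>\<in>exponents J n. c \<alpha> * monomial J \<alpha> z) = 0)"
proof -
  obtain L0 where Q0: "Q \<in> poly_funs I L0" using assms by (auto simp: polynomial_on_def)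
  obtain L1 where G1: "\<forall>j\<in>J. G j \<in> poly_funs I L1"
    using polynomial_on_common_degree[of J I G] assms by blast
  define L where "L = max L0 L1"
  have Q: "Q \<in> poly_funs I L" and G: "\<And>j. j \<in> J \<Longrightarrow> G j \<in> poly_funs I L"
    using Q0 G1 poly_funs_mono[of L0 L I] poly_funs_mono[of L1 L I] by (auto simp: L_def)
  \<comment> \<open>Chosen so that \<open>e + 1 \<le> C * (n + 1)\<close> and
    \<open>C ^ card I = n\<close>, whence \<open>(e + 1) ^ card I \<le> n * (n + 1) ^ card I < (n +
    1) ^ (card I + 1)\<close>.\<close>
  define C where "C = card J * L + 1"
  define n where "n = C ^ card I"
  define e where "e = card J * n * L"
  \<comment> \<open>The monomial \<open>\<alpha>\<close> in the quotients \<open>G j / Q\<close>,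
    cleared of denominators; by \<open>le\<close> the subtraction does not truncate.\<close>
  define R where "R \<alpha> y = Q y ^ (card J * n - sum \<alpha> J) * (\<Prod>j\<in>J. G j y ^ \<alpha> j)" for \<alpha> y
  have le: "sum \<alpha> J \<le> card J * n" if "\<alpha> \<in> exponents J n" for \<alpha>
    using sum_bounded_above[of J \<alpha> n] that by (auto simp: exponents_def PiE_def Pi_def)
  have "R \<alpha> \<in> poly_funs I e" if "\<alpha> \<in> exponents J n" for \<alpha>
  proof -
    have "(\<lambda>y. \<Prod>j\<in>J. G j y ^ \<alpha> j) \<in> poly_funs I (\<Sum>j\<in>J. \<alpha> j * L)"
      by (intro poly_funs_prod poly_funs_power G)
    then have "R \<alpha> \<in> poly_funs I ((card J * n - sum \<alpha> J) * L + (\<Sum>j\<in>J. \<alpha> j * L))"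
      unfolding R_def by (rule poly_funs_mult[OF poly_funs_power[OF Q]])
    moreover have "(card J * n - sum \<alpha> J) * L + (\<Sum>j\<in>J. \<alpha> j * L) = e"
      using le[OF that] by (simp add: e_def flip: sum_distrib_right add_mult_distrib)
    ultimately show ?thesis by simp
  qed
  moreover have "card (monomial I ` exponents I e :: (('i \<Rightarrow> 'a) \<Rightarrow> 'a) set) < card (exponents J n)"
  proof -
    have "card (monomial I ` exponents I e :: (('i \<Rightarrow> 'a) \<Rightarrow> 'a) set) \<le> (e + 1) ^ card I"
      using card_image_le[OF finite_exponents[OF \<open>finite I\<close>], of "monomial I" e]
      by (simp add: card_exponents \<open>finite I\<close>)
    also have "\<dots> \<le> (C * (n + 1)) ^ card I"
      by (intro power_mono) (auto simp: e_def C_def algebra_simps)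
    also have "\<dots> = n * (n + 1) ^ card I"
      unfolding power_mult_distrib n_def[symmetric] ..
    also have "\<dots> < (n + 1) ^ (card I + 1)"
      by simp
    also have "\<dots> \<le> (n + 1) ^ card J"
      using assms by (intro power_increasing) auto
    also have "\<dots> = card (exponents J n)" by (simp add: card_exponents \<open>finite J\<close>)
    finally show ?thesis .
  qed
  ultimately obtain c where c: "\<exists>\<alpha>\<in>exponents J n. c \<alpha> \<noteq> 0"
      "\<And>y. (\<Sum>\<alpha>\<in>exponents J n. c \<alpha> * R \<alpha> y) = 0"
    using exists_linear_relation[of "exponents J n" "monomial I ` exponents I e" R] assms(1,2)
    by (auto simp: poly_funs_def)
  have "(\<Sum>\<alpha>\<in>exponents J n. c \<alpha> * monomial J \<alpha> z) = 0"
    if "Q y \<noteq> 0" and z: "\<forall>j\<in>J. Q y * z j = G j y" for y z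
  proof -
    have "R \<alpha> y = Q y ^ (card J * n) * monomial J \<alpha> z" if "\<alpha> \<in> exponents J n" for \<alpha>
    proof -
      have "(\<Prod>j\<in>J. G j y ^ \<alpha> j) = (\<Prod>j\<in>J. Q y ^ \<alpha> j * z j ^ \<alpha> j)"
        using z by (intro prod.cong) (auto simp flip: power_mult_distrib)
      also have "\<dots> = Q y ^ sum \<alpha> J * monomial J \<alpha> z"
        by (simp add: prod.distrib monomial_def power_sum)
      finally show ?thesis
        using le[OF that] by (simp add: R_def mult.assoc[symmetric] flip: power_add)
    qed
    then have "Q y ^ (card J * n) * (\<Sum>\<alpha>\<in>exponents J n. c \<alpha> * monomial J \<alpha> z) = 0"
      using c(2)[of y] by (simp add: sum_distrib_left mult.left_commute)
    then show ?thesis using \<open>Q y \<noteq> 0\<close> by simp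
  qed
  then show ?thesis using c(1) by blast
qed

subsection \<open>Nonvanishing of polynomials\<close>

lemma sum_exponents_insert:
  assumes "j \<notin> J"
  shows "(\<Sum>\<alpha>\<in>exponents (insert j J) n. g \<alpha>) = (\<Sum>l\<le>n. \<Sum>\<alpha>\<in>exponents J n. g (\<alpha>(j := l)))"
proof -
  have "(\<Sum>\<alpha>\<in>exponents (insert j J) n. g \<alpha>)
      = (\<Sum>x\<in>{..n} \<times> exponents J n. g (case x of (l, \<alpha>) \<Rightarrow> \<alpha>(j := l)))"
    unfolding exponents_def PiE_insert_eq
    by (subst sum.reindex) (use assms in \<open>auto intro: inj_combinator\<close>)
  then show ?thesis by (simp add: sum.cartesian_product case_prod_beta)
qed

lemma exponents_insertE:
  assumes "\<alpha> \<in> exponents (insert j J) n" "j \<notin> J"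
  obtains l \<beta> where "l \<le> n" "\<beta> \<in> exponents J n" "\<alpha> = \<beta>(j := l)"
  using assms unfolding exponents_def PiE_insert_eq by auto

lemma monomial_insert:
  assumes "finite J" "j \<notin> J"
  shows "monomial (insert j J) (\<alpha>(j := l)) z = z j ^ l * monomial J \<alpha> z"
proof -
  have "monomial J (\<alpha>(j := l)) z = monomial J \<alpha> z"
    unfolding monomial_def using assms by (intro prod.cong) auto
  then show ?thesis using assms by (simp add: monomial_def)
qed

text \<open>Collecting powers of one variable serves both induction on the variables and division by
  a power of that variable.\<close>

lemma sum_monomials_insert:
  fixes c :: "_ \<Rightarrow> 'a::comm_semiring_1"
  assumes "finite J" "j \<notin> J"
  shows "(\<Sum>\<alpha>\<in>exponents (insert j J) n. c \<alpha> * monomial (insert j J) \<alpha> z)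
    = (\<Sum>l\<le>n. z j ^ l * (\<Sum>\<alpha>\<in>exponents J n. c (\<alpha>(j := l)) * monomial J \<alpha> z))"
  by (simp add: sum_exponents_insert monomial_insert assms sum_distrib_left mult.left_commute)

text \<open>Induction on the variables. For each \<open>r\<close> some coefficient, as a polynomial
  in the new variable, is nonzero. These finitely many polynomials have finitely many roots, so one
  value \<open>x\<close> avoids them all and leaves nonzero polynomials in the remaining
  variables.\<close>

lemma exists_common_nonzero:
  fixes c :: "'r \<Rightarrow> ('j \<Rightarrow> nat) \<Rightarrow> 'a::real_normed_field"
  assumes "finite J" "finite R" "\<And>r. r \<in> R \<Longrightarrow> \<exists>\<alpha>\<in>exponents J (n r). c r \<alpha> \<noteq> 0"
  shows "\<exists>z. \<forall>r\<in>R. (\<Sum>\<alpha>\<in>exponents J (n r). c r \<alpha> * monomial J \<alpha> z) \<noteq> 0"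
  using assms(1,3)
proof (induction J arbitrary: c)
  case empty
  then show ?case by (auto simp: exponents_def monomial_def)
next
  case (insert j J)
  have "\<exists>\<beta>\<in>exponents J (n r). \<exists>l\<le>n r. c r (\<beta>(j := l)) \<noteq> 0" if "r \<in> R" for r
    using insert.prems[OF that] insert.hyps(2) by (auto elim!: exponents_insertE)
  then obtain \<beta> where \<beta>: "\<beta> r \<in> exponents J (n r)" "\<exists>l\<le>n r. c r ((\<beta> r)(j := l)) \<noteq> 0"
    if "r \<in> R" for r by metis
  have "finite (\<Union>r\<in>R. {x. (\<Sum>l\<le>n r. c r ((\<beta> r)(j := l)) * x ^ l) = 0})"
    by (intro finite_UN_I \<open>finite R\<close>, subst polyfun_finite_roots) (rule \<beta>(2))
  then obtain x where x: "(\<Sum>l\<le>n r. c r ((\<beta> r)(j := l)) * x ^ l) \<noteq> 0" if "r \<in> R" for r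
    using ex_new_if_finite[OF infinite_UNIV_char_0] by blast
  obtain z where z: "\<forall>r\<in>R. (\<Sum>\<alpha>\<in>exponents J (n r).
      (\<Sum>l\<le>n r. c r (\<alpha>(j := l)) * x ^ l) * monomial J \<alpha> z) \<noteq> 0"
    using insert.IH[of "\<lambda>r \<alpha>. \<Sum>l\<le>n r. c r (\<alpha>(j := l)) * x ^ l"] \<beta>(1) x by blast
  have [simp]: "monomial J \<alpha> (z(j := x)) = monomial J \<alpha> z" for \<alpha>
    unfolding monomial_def using insert.hyps by (intro prod.cong) auto
  have "(\<Sum>\<alpha>\<in>exponents J (n r). (\<Sum>l\<le>n r. c r (\<alpha>(j := l)) * x ^ l) * monomial J \<alpha> z)
      = (\<Sum>\<alpha>\<in>exponents (insert j J) (n r). c r \<alpha> * monomial (insert j J) \<alpha> (z(j := x)))" for r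
    unfolding sum_monomials_insert[OF insert.hyps(1,2)] sum_distrib_left sum_distrib_right
    by (subst sum.swap) (simp add: mult_ac)
  with z show ?case
    by (intro exI[of _ "z(j := x)"]) (simp only:)
qed

lemma continuous_on_monomial [continuous_intros]:
  "continuous_on A (monomial J \<alpha> :: ('j \<Rightarrow> 'a::real_normed_field) \<Rightarrow> 'a)"
  unfolding monomial_def
  by (intro continuous_intros continuous_on_subset[OF continuous_on_product_coordinates]) auto

text \<open>A nonzero polynomial, divided by the largest possible power of the coordinate \<open>e\<close>,
  does not vanish identically on the hyperplane where that coordinate is zero.\<close>

lemma exists_nonzero_near_hyperplane:
  fixes c :: "'r \<Rightarrow> ('j \<Rightarrow> nat) \<Rightarrow> 'a::real_normed_field"
  assumes "finite J" "e \<notin> J" "finite R"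
    and ne: "\<And>r. r \<in> R \<Longrightarrow> \<exists>\<alpha>\<in>exponents (insert e J) (n r). c r \<alpha> \<noteq> 0"
  shows "\<exists>z U. open U \<and> z \<in> U \<and> z e = 0 \<and> (\<forall>r\<in>R. \<forall>z'\<in>U. z' e \<noteq> 0 \<longrightarrow>
    (\<Sum>\<alpha>\<in>exponents (insert e J) (n r). c r \<alpha> * monomial (insert e J) \<alpha> z') \<noteq> 0)"
proof -
  define A where "A r l z = (\<Sum>\<alpha>\<in>exponents J (n r). c r (\<alpha>(e := l)) * monomial J \<alpha> z)" for r l z
  define P where "P r l \<longleftrightarrow> (\<exists>\<alpha>\<in>exponents J (n r). c r (\<alpha>(e := l)) \<noteq> 0)" for r l
  \<comment> \<open>The exact power of the coordinate \<open>e\<close> that divides the polynomial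
    \<open>r\<close>.\<close>
  define m where "m r = (LEAST l. P r l)" for r
  have ex: "\<exists>l\<le>n r. P r l" if "r \<in> R" for r
    using ne[OF that] \<open>e \<notin> J\<close> unfolding P_def by (auto elim!: exponents_insertE)
  then have Pm: "P r (m r)" if "r \<in> R" for r
    using that LeastI[of "P r"] unfolding m_def by blast
  have m_le: "m r \<le> n r" if "r \<in> R" for r
    using ex[OF that] Least_le[of "P r"] unfolding m_def by (meson order_trans)
  have A0: "A r l z = 0" if "l < m r" for r l z
    using not_less_Least[of l "P r"] that unfolding A_def P_def m_def by (intro sum.neutral) auto
  obtain z where z: "\<forall>r\<in>R. A r (m r) z \<noteq> 0"
    using exists_common_nonzero[OF assms(1,3), of n "\<lambda>r \<alpha>. c r (\<alpha>(e := m r))"] Pm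
    unfolding A_def P_def by blast
  \<comment> \<open>The quotient by that power. On the hyperplane only its term
    \<open>A r (m r) z\<close> survives, and by continuity it stays nonzero nearby.\<close>
  define H where "H r z = (\<Sum>l=m r..n r. z e ^ (l - m r) * A r l z)" for r and z :: "'j \<Rightarrow> 'a"
  define U where "U = (\<Inter>r\<in>R. {z. H r z \<noteq> 0})"
  have "continuous_on UNIV (H r)" for r
    unfolding H_def A_def by (intro continuous_intros continuous_on_product_coordinates)
  then have "open U"
    unfolding U_def using \<open>finite R\<close> by (intro open_INT ballI open_Collect_neq continuous_on_const) simp_all
  moreover have "z(e := 0) \<in> U"
  proof -
    have [simp]: "monomial J \<alpha> (z(e := 0)) = monomial J \<alpha> z" for \<alpha>
      unfolding monomial_def using \<open>e \<notin> J\<close> by (intro prod.cong) auto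
    have "H r (z(e := 0)) = A r (m r) z" if "r \<in> R" for r
    proof -
      have "H r (z(e := 0)) = (\<Sum>l=m r..n r. if l = m r then A r l z else 0)"
        unfolding H_def by (intro sum.cong) (simp_all add: A_def)
      then show ?thesis using m_le[OF that] by simp
    qed
    then show ?thesis using z by (auto simp: U_def)
  qed
  moreover have "(\<Sum>\<alpha>\<in>exponents (insert e J) (n r). c r \<alpha> * monomial (insert e J) \<alpha> z') \<noteq> 0"
    if "r \<in> R" "z' \<in> U" "z' e \<noteq> 0" for r z'
  proof -
    have "(\<Sum>\<alpha>\<in>exponents (insert e J) (n r). c r \<alpha> * monomial (insert e J) \<alpha> z')
        = (\<Sum>l\<le>n r. z' e ^ l * A r l z')"
      unfolding A_def by (rule sum_monomials_insert[OF assms(1,2)])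
    also have "\<dots> = (\<Sum>l=m r..n r. z' e ^ l * A r l z')"
      using A0 by (intro sum.mono_neutral_right) auto
    also have "\<dots> = z' e ^ m r * H r z'"
      unfolding H_def sum_distrib_left by (intro sum.cong) (simp_all flip: mult.assoc power_add)
    finally show ?thesis using that by (simp add: U_def)
  qed
  ultimately show ?thesis
    by (intro exI[of _ "z(e := 0)"] exI[of _ U] conjI ballI impI) simp_all
qed

text \<open>A product of \<open>k - 1\<close> linear factors, one for each other point and vanishing
  there but not at \<open>p 0\<close>, has degree at most \<open>k - 1\<close> in each variable. If
  all monomial sums were zero, so would be the sum for this product, which is \<open>u 0\<close>
  times a nonzero value.\<close>

lemma exists_nonzero_evaluation:
  fixes p :: "nat \<Rightarrow> 'a::field ^ 'm::finite"
  assumes "inj_on p {..<k}" "0 < k" "u 0 \<noteq> 0"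
  shows "\<exists>\<beta>\<in>exponents UNIV (k - 1). (\<Sum>i<k. u i * monomial UNIV \<beta> (($) (p i))) \<noteq> 0"
proof (rule ccontr)
  assume "\<not> ?thesis"
  then have zero: "(\<Sum>i<k. u i * monomial UNIV \<beta> (($) (p i))) = 0"
    if "\<beta> \<in> exponents UNIV (k - 1)" for \<beta> using that by blast
  have all: "(\<Sum>i<k. u i * f (($) (p i))) = 0" if "f \<in> poly_funs UNIV (k - 1)" for f
    using that
  proof (induction rule: poly_funs_induct)
    case (add c \<beta> g)
    have "(\<Sum>i<k. u i * (c * monomial UNIV \<beta> (($) (p i)) + g (($) (p i))))
        = c * (\<Sum>i<k. u i * monomial UNIV \<beta> (($) (p i))) + (\<Sum>i<k. u i * g (($) (p i)))"
      by (simp add: algebra_simps sum.distrib sum_distrib_left)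
    then show ?case using add zero by simp
  qed simp
  have "\<exists>t. p i $ t \<noteq> p 0 $ t" if "i \<in> {1..<k}" for i
    using inj_onD[OF assms(1), of i 0] that assms(2) by (auto simp: vec_eq_iff)
  then obtain t where t: "p i $ t i \<noteq> p 0 $ t i" if "i \<in> {1..<k}" for i by metis
  define f where "f y = (\<Prod>i\<in>{1..<k}. y (t i) - p i $ t i)" for y
  have "(\<lambda>y. y (t i) - p i $ t i) \<in> poly_funs UNIV 1" for i
    using poly_funs_add[OF poly_funs_var[of UNIV "t i"] poly_funs_const[of "- (p i $ t i)"]] by simp
  then have "f \<in> poly_funs UNIV (\<Sum>i\<in>{1..<k}. 1)"
    unfolding f_def by (rule poly_funs_prod)
  then have "(\<Sum>i<k. u i * f (($) (p i))) = 0"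
    using all by simp
  moreover have "f (($) (p i)) = 0" if "i \<in> {..<k} - {0}" for i
    unfolding f_def using that by (intro prod_zero) auto
  then have "(\<Sum>i<k. u i * f (($) (p i))) = (\<Sum>i\<in>{0}. u i * f (($) (p i)))"
    using assms(2) by (intro sum.mono_neutral_right) auto
  moreover have "f (($) (p 0)) \<noteq> 0"
    unfolding f_def using t[THEN not_sym] by (simp add: prod_zero_iff)
  ultimately show False using \<open>u 0 \<noteq> 0\<close> by simp
qed

subsection \<open>Linear dependencies between values of a polynomial map\<close>

text \<open>\<open>Coeff j \<beta>\<close> is the coefficient of the monomial \<open>\<beta>\<close> in the \<open>j\<close>-th component of the map,
  \<open>Coord i t\<close> the \<open>t\<close>-th coordinate of the \<open>i\<close>-th point, \<open>Weight i\<close> the coefficient of that point in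
  a linear dependency, and \<open>Gap\<close> a coordinate of the difference of the points 1 and 0.\<close>

datatype ('m, 'n) var = Coeff 'n "'m \<Rightarrow> nat" | Coord nat 'm | Weight nat | Gap

abbreviation degs :: "nat \<Rightarrow> ('m \<Rightarrow> nat) set" where
  "degs k \<equiv> exponents UNIV (k - 1)"

text \<open>Together with \<open>Gap\<close>, these are the coordinates of a triple of map, first
  point and gap.\<close>

definition map_vars :: "nat \<Rightarrow> ('m, 'n) var set" where
  "map_vars k = (\<lambda>(j, \<beta>). Coeff j \<beta>) ` (UNIV \<times> degs k) \<union> range (Coord 0)"

text \<open>The coefficients at \<open>s\<close> are left out because a dependency determines them.
  Weights start at index 1 because point 0 has weight 1.\<close>

definition source_vars :: "nat \<Rightarrow> ('m \<Rightarrow> nat) \<Rightarrow> ('m, 'n) var set" where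
  "source_vars k s = (\<lambda>(j, \<beta>). Coeff j \<beta>) ` (UNIV \<times> (degs k - {s}))
     \<union> (\<lambda>(i, t). Coord i t) ` ({..<k} \<times> UNIV) \<union> Weight ` {1..<k}"

lemma finite_map_vars [simp]: "finite (map_vars k :: ('m::finite, 'n::finite) var set)"
  by (simp add: map_vars_def)

lemma Gap_notin_map_vars: "Gap \<notin> map_vars k"
  by (auto simp: map_vars_def)

lemma finite_source_vars [simp]: "finite (source_vars k s :: ('m::finite, 'n::finite) var set)"
  by (simp add: source_vars_def)

lemma card_map_vars:
  "card (map_vars k :: ('m::finite, 'n::finite) var set)
    = CARD('n) * card (degs k :: ('m \<Rightarrow> nat) set) + CARD('m)"
proof -
  have "card ((\<lambda>(j, \<beta>). Coeff j \<beta>) ` (UNIV \<times> degs k) :: ('m, 'n) var set)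
      = CARD('n) * card (degs k :: ('m \<Rightarrow> nat) set)"
    by (subst card_image) (auto simp: inj_on_def card_cartesian_product)
  moreover have "card (range (Coord 0) :: ('m, 'n) var set) = CARD('m)"
    by (subst card_image) (auto simp: inj_on_def)
  ultimately show ?thesis
    unfolding map_vars_def by (subst card_Un_disjoint) auto
qed

lemma card_source_vars:
  assumes "s \<in> degs k"
  shows "card (source_vars k s :: ('m::finite, 'n::finite) var set)
    = CARD('n) * (card (degs k :: ('m \<Rightarrow> nat) set) - 1) + k * CARD('m) + (k - 1)"
proof -
  have "card ((\<lambda>(j, \<beta>). Coeff j \<beta>) ` (UNIV \<times> (degs k - {s})) :: ('m, 'n) var set)
      = CARD('n) * (card (degs k :: ('m \<Rightarrow> nat) set) - 1)"
    using assms by (subst card_image) (auto simp: inj_on_def card_cartesian_product)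
  moreover have "card ((\<lambda>(i, t). Coord i t) ` ({..<k} \<times> UNIV) :: ('m, 'n) var set) = k * CARD('m)"
    by (subst card_image) (auto simp: inj_on_def card_cartesian_product)
  moreover have "card (Weight ` {1..<k} :: ('m, 'n) var set) = k - 1"
    by (subst card_image) (auto simp: inj_on_def)
  ultimately show ?thesis
    unfolding source_vars_def by (subst card_Un_disjoint; (subst card_Un_disjoint)?) auto
qed

text \<open>With N components and D monomials, N(D - 1) + km + (k - 1) is compared with ND + m + 1.
  For N = (m + 1)(k - 1) the difference is exactly one.\<close>

lemma card_source_vars_less:
  assumes "k \<ge> 2" "CARD('n::finite) = (CARD('m::finite) + 1) * (k - 1)" "s \<in> degs k"
  shows "card (source_vars k s :: ('m, 'n) var set) < card (insert Gap (map_vars k) :: ('m, 'n) var set)"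
proof -
  obtain d where d: "card (degs k :: ('m \<Rightarrow> nat) set) = Suc d"
    using assms(3) by (metis card_Suc_Diff1 finite finite_exponents)
  obtain l where l: "k = Suc l" using assms(1) by (cases k) auto
  show ?thesis
    unfolding card_source_vars[OF assms(3)] card_insert_disjoint[OF finite_map_vars Gap_notin_map_vars]
      card_map_vars d assms(2) by (simp add: l algebra_simps)
qed

text \<open>The existential forgets the weights and all points but \<open>p 0\<close>, keeping just
  one coordinate of \<open>p 1 - p 0\<close>. The last conjunct is the vanishing of the weighted sum
  of map values, with the two sums exchanged.\<close>

definition dependency :: "nat \<Rightarrow> ('m \<Rightarrow> nat) \<Rightarrow> 'm \<Rightarrow> (('m::finite, 'n) var \<Rightarrow> 'a::field) \<Rightarrow> bool" where
  "dependency k s t z \<longleftrightarrow> (\<exists>(p :: nat \<Rightarrow> 'a ^ 'm) u. u 0 = 1 \<and>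
    (\<forall>t'. z (Coord 0 t') = p 0 $ t') \<and> z Gap = p 1 $ t - p 0 $ t \<and>
    (\<Sum>i<k. u i * monomial UNIV s (($) (p i))) \<noteq> 0 \<and>
    (\<forall>j. (\<Sum>\<beta>\<in>degs k. z (Coeff j \<beta>) * (\<Sum>i<k. u i * monomial UNIV \<beta> (($) (p i)))) = 0))"

text \<open>If \<open>\<Sum>\<^sub>i u\<^sub>i f(p\<^sub>i) = 0\<close> and the weighted sum of the monomial \<open>s\<close> is nonzero, the coefficients of \<open>f\<close>
  at \<open>s\<close> are rational functions of the source variables, with that sum as common denominator.\<close>

lemma exists_dependency_relation:
  assumes k: "k \<ge> 2" and card: "CARD('n::finite) = (CARD('m::finite) + 1) * (k - 1)"
    and s: "s \<in> (degs k :: ('m \<Rightarrow> nat) set)"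
  shows "\<exists>d c. (\<exists>\<alpha>\<in>exponents (insert Gap (map_vars k)) d. c \<alpha> \<noteq> 0) \<and>
    (\<forall>z :: ('m, 'n) var \<Rightarrow> 'a::field. dependency k s t z \<longrightarrow>
      (\<Sum>\<alpha>\<in>exponents (insert Gap (map_vars k)) d. c \<alpha> * monomial (insert Gap (map_vars k)) \<alpha> z) = 0)"
proof -
  define w :: "('m \<Rightarrow> nat) \<Rightarrow> (('m, 'n) var \<Rightarrow> 'a) \<Rightarrow> 'a" where
    "w \<beta> y = (\<Sum>i<k. (if i = 0 then 1 else y (Weight i)) * (\<Prod>t\<in>UNIV. y (Coord i t) ^ \<beta> t))" for \<beta> y
  \<comment> \<open>Numerators over the common denominator \<open>w s\<close>. At
    \<open>Coeff j s\<close> the equation of component \<open>j\<close> is solved for that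
    coefficient. The \<open>Weight\<close> value is a dummy, since \<open>map_vars k\<close>
    contains no weights.\<close>
  define G where "G v y = (case v of
      Coeff j \<beta> \<Rightarrow> if \<beta> = s then - (\<Sum>\<beta>'\<in>degs k - {s}. y (Coeff j \<beta>') * w \<beta>' y) else w s y * y v
    | Coord i t' \<Rightarrow> w s y * y (Coord i t')
    | Weight i \<Rightarrow> 0
    | Gap \<Rightarrow> w s y * (y (Coord 1 t) - y (Coord 0 t)))" for v and y :: "('m, 'n) var \<Rightarrow> 'a"
  have weight: "polynomial_on (source_vars k s) (\<lambda>y. if i = 0 then 1 else y (Weight i :: ('m, 'n) var) :: 'a)"
    if "i < k" for i
  proof (cases "i = 0")
    case False
    then have "(Weight i :: ('m, 'n) var) \<in> source_vars k s"
      using that by (simp add: source_vars_def)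
    then show ?thesis
      using False by (simp add: polynomial_on_var)
  qed (simp add: polynomial_on_const)
  have coord: "polynomial_on (source_vars k s) (\<lambda>y. y (Coord i t' :: ('m, 'n) var) :: 'a)" if "i < k" for i t'
    using that by (intro polynomial_on_var) (auto simp: source_vars_def)
  have coeff: "polynomial_on (source_vars k s) (\<lambda>y. y (Coeff j \<beta> :: ('m, 'n) var) :: 'a)"
    if "\<beta> \<in> degs k - {s}" for j \<beta>
    using that by (intro polynomial_on_var) (auto simp: source_vars_def)
  have w: "polynomial_on (source_vars k s) (w \<beta>)" for \<beta>
    unfolding w_def by (intro polynomial_on_sum polynomial_on_mult polynomial_on_prod
      polynomial_on_power weight coord) auto
  have G: "polynomial_on (source_vars k s) (G v)" if "v \<in> insert Gap (map_vars k)" for v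
  proof (cases v)
    case (Coeff j \<beta>)
    have "polynomial_on (source_vars k s) (\<lambda>y. - (\<Sum>\<beta>'\<in>degs k - {s}. y (Coeff j \<beta>') * w \<beta>' y))"
      by (intro polynomial_on_uminus polynomial_on_sum polynomial_on_mult coeff w)
    moreover have "polynomial_on (source_vars k s) (\<lambda>y. w s y * y v)" if "\<beta> \<noteq> s"
      using \<open>v \<in> _\<close> that Coeff by (auto simp: map_vars_def intro!: polynomial_on_mult w coeff)
    ultimately show ?thesis
      using Coeff by (cases "\<beta> = s") (simp_all add: G_def[abs_def])
  next
    case (Coord i t')
    then have "i = 0" using that by (auto simp: map_vars_def)
    then show ?thesis
      using Coord k by (auto simp: G_def[abs_def] intro!: polynomial_on_mult w coord)
  next
    case (Weight i)
    then show ?thesis by (simp add: G_def[abs_def] polynomial_on_const)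
  next
    case Gap
    then show ?thesis
      using k by (auto simp: G_def[abs_def] intro!: polynomial_on_mult polynomial_on_diff w coord)
  qed
  have "\<exists>d c. (\<exists>\<alpha>\<in>exponents (insert Gap (map_vars k)) d. c \<alpha> \<noteq> 0) \<and>
    (\<forall>y z. w s y \<noteq> 0 \<longrightarrow> (\<forall>v\<in>insert Gap (map_vars k). w s y * z v = G v y) \<longrightarrow>
      (\<Sum>\<alpha>\<in>exponents (insert Gap (map_vars k)) d. c \<alpha> * monomial (insert Gap (map_vars k)) \<alpha> z) = 0)"
    using card_source_vars_less[OF k card s] w G by (intro exists_algebraic_relation) simp_all
  then obtain d c where c: "\<exists>\<alpha>\<in>exponents (insert Gap (map_vars k)) d. c \<alpha> \<noteq> 0"
    and rel: "\<And>y z. w s y \<noteq> 0 \<Longrightarrow> \<forall>v\<in>insert Gap (map_vars k). w s y * z v = G v y \<Longrightarrow>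
      (\<Sum>\<alpha>\<in>exponents (insert Gap (map_vars k)) d. c \<alpha> * monomial (insert Gap (map_vars k)) \<alpha> z) = 0"
    by blast
  show ?thesis
  proof (intro exI[of _ d] exI[of _ c] conjI allI impI c)
    fix z :: "('m, 'n) var \<Rightarrow> 'a"
    assume "dependency k s t z"
    then obtain p :: "nat \<Rightarrow> 'a ^ 'm" and u where u: "u 0 = 1"
      and p0: "\<forall>t'. z (Coord 0 t') = p 0 $ t'" and gap: "z Gap = p 1 $ t - p 0 $ t"
      and ne: "(\<Sum>i<k. u i * monomial UNIV s (($) (p i))) \<noteq> 0"
      and dep: "\<forall>j. (\<Sum>\<beta>\<in>degs k. z (Coeff j \<beta>) * (\<Sum>i<k. u i * monomial UNIV \<beta> (($) (p i)))) = 0"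
      unfolding dependency_def by blast
    \<comment> \<open>The source point given by the dependency, with a dummy value at
      \<open>Gap\<close>, which is not a source variable.\<close>
    define y where "y v = (case v of Coeff j \<beta> \<Rightarrow> z v | Coord i t' \<Rightarrow> p i $ t' | Weight i \<Rightarrow> u i | Gap \<Rightarrow> 0)" for v
    have wy: "w \<beta> y = (\<Sum>i<k. u i * monomial UNIV \<beta> (($) (p i)))" for \<beta>
      unfolding w_def monomial_def using u by (intro sum.cong) (auto simp: y_def)
    have "w s y * z v = G v y" if "v \<in> insert Gap (map_vars k)" for v
    proof (cases v)
      case (Coeff j \<beta>)
      have "(\<Sum>\<beta>\<in>degs k. z (Coeff j \<beta>) * w \<beta> y) = 0"
        using dep by (simp add: wy)
      then have "z (Coeff j s) * w s y + (\<Sum>\<beta>\<in>degs k - {s}. z (Coeff j \<beta>) * w \<beta> y) = 0"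
        by (subst (asm) sum.remove[OF _ s]) simp_all
      then have "w s y * z (Coeff j s) = - (\<Sum>\<beta>\<in>degs k - {s}. z (Coeff j \<beta>) * w \<beta> y)"
        by (simp add: eq_neg_iff_add_eq_0 mult.commute)
      then show ?thesis
        using Coeff by (cases "\<beta> = s") (simp_all add: G_def y_def)
    next
      case (Coord i t')
      then have "i = 0" using that by (auto simp: map_vars_def)
      then show ?thesis using p0 Coord by (simp add: G_def y_def)
    next
      case (Weight i)
      then show ?thesis using that by (auto simp: map_vars_def)
    next
      case Gap
      then show ?thesis using gap by (simp add: G_def y_def)
    qed
    then show "(\<Sum>\<alpha>\<in>exponents (insert Gap (map_vars k)) d.
        c \<alpha> * monomial (insert Gap (map_vars k)) \<alpha> z) = 0"
      using ne by (intro rel[of y z]) (simp_all add: wy)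
  qed
qed

text \<open>Each of the finitely many pairs \<open>(s, t)\<close> has its own relation. A single
  point with \<open>Gap\<close> zero, near which no relation vanishes where \<open>Gap\<close> is
  nonzero, supplies both the coefficients \<open>C\<close> and the centre \<open>q\<close>. A
  dependency close to \<open>q\<close> contradicts this for a suitable pair.\<close>

lemma exists_locally_regular_polynomial:
  assumes k: "k \<ge> 2" and card: "CARD('n::finite) = (CARD('m::finite) + 1) * (k - 1)"
  shows "\<exists>(C :: 'n \<Rightarrow> ('m \<Rightarrow> nat) \<Rightarrow> 'a::real_normed_field) (q :: 'a ^ 'm) \<delta>. \<delta> > 0 \<and>
    (\<forall>p u. inj_on p {..<k} \<longrightarrow> p ` {..<k} \<subseteq> ball q \<delta> \<longrightarrow> u 0 = 1 \<longrightarrow>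
      (\<exists>j. (\<Sum>i<k. u i * (\<Sum>\<beta>\<in>degs k. C j \<beta> * monomial UNIV \<beta> (($) (p i)))) \<noteq> 0))"
proof -
  let ?J = "insert Gap (map_vars k) :: ('m, 'n) var set"
  let ?R = "degs k \<times> UNIV :: (('m \<Rightarrow> nat) \<times> 'm) set"
  define relation where "relation r d c \<longleftrightarrow> (\<exists>\<alpha>\<in>exponents ?J d. c \<alpha> \<noteq> 0) \<and>
      (\<forall>z :: ('m, 'n) var \<Rightarrow> 'a. dependency k (fst r) (snd r) z \<longrightarrow>
        (\<Sum>\<alpha>\<in>exponents ?J d. c \<alpha> * monomial ?J \<alpha> z) = 0)" for r d c
  have "\<forall>r\<in>?R. \<exists>d c. relation r d c"
    unfolding relation_def by (intro ballI exists_dependency_relation[OF k card]) auto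
  then obtain d c where dc: "\<And>r. r \<in> ?R \<Longrightarrow> relation r (d r) (c r)"
    by metis
  then have c: "\<And>r. r \<in> ?R \<Longrightarrow> \<exists>\<alpha>\<in>exponents ?J (d r). c r \<alpha> \<noteq> 0"
    and rel: "\<And>r (z :: ('m, 'n) var \<Rightarrow> 'a). r \<in> ?R \<Longrightarrow> dependency k (fst r) (snd r) z \<Longrightarrow>
      (\<Sum>\<alpha>\<in>exponents ?J (d r). c r \<alpha> * monomial ?J \<alpha> z) = 0"
    unfolding relation_def by blast+
  have "\<exists>z U. open U \<and> z \<in> U \<and> z Gap = 0 \<and> (\<forall>r\<in>?R. \<forall>z'\<in>U. z' Gap \<noteq> 0 \<longrightarrow>
      (\<Sum>\<alpha>\<in>exponents ?J (d r). c r \<alpha> * monomial ?J \<alpha> z') \<noteq> 0)"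
    by (intro exists_nonzero_near_hyperplane c Gap_notin_map_vars) simp_all
  then obtain z U where "open U" "z \<in> U" "z Gap = 0"
    and U: "\<And>r z'. r \<in> ?R \<Longrightarrow> z' \<in> U \<Longrightarrow> z' Gap \<noteq> 0 \<Longrightarrow>
      (\<Sum>\<alpha>\<in>exponents ?J (d r). c r \<alpha> * monomial ?J \<alpha> z') \<noteq> 0"
    by blast
  define C where "C j \<beta> = z (Coeff j \<beta>)" for j \<beta>
  define q :: "'a ^ 'm" where "q = (\<chi> t. z (Coord 0 t))"
  \<comment> \<open>Fixes the map and varies only the first point and the gap; continuity makes the
    preimage of \<open>U\<close> a neighbourhood of \<open>(q, 0)\<close>.\<close>
  define Z where "Z x v = (case v of Coord i t \<Rightarrow> if i = 0 then fst x $ t else z v | Gap \<Rightarrow> snd x | _ \<Rightarrow> z v)"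
    for x :: "('a ^ 'm) \<times> 'a" and v
  have "continuous_on UNIV (\<lambda>x :: ('a ^ 'm) \<times> 'a. if i = 0 then fst x $ t else z v)" for i :: nat and t v
    by (cases "i = 0") (auto intro!: continuous_intros)
  then have "continuous_on UNIV (\<lambda>x. Z x v)" for v
    unfolding Z_def by (cases v) (auto intro!: continuous_intros)
  then have "continuous_on UNIV Z"
    by (rule continuous_on_coordinatewise_then_product)
  then have "open (Z -` U)"
    using \<open>open U\<close> by (simp add: open_vimage)
  moreover have "Z (q, 0) = z"
    using \<open>z Gap = 0\<close> by (auto simp: Z_def q_def fun_eq_iff split: var.split)
  then have "(q, 0) \<in> Z -` U"
    using \<open>z \<in> U\<close> by simp
  ultimately obtain A B where AB: "open A" "open B" "q \<in> A" "0 \<in> B" "A \<times> B \<subseteq> Z -` U"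
    by (elim open_prod_elim) auto
  obtain \<delta>1 \<delta>2 where \<delta>: "\<delta>1 > 0" "ball q \<delta>1 \<subseteq> A" "\<delta>2 > 0" "ball 0 \<delta>2 \<subseteq> B"
    using open_contains_ball[THEN iffD1, OF AB(1)] open_contains_ball[THEN iffD1, OF AB(2)] AB(3,4)
    by blast
  \<comment> \<open>Halving keeps any two points of the ball at distance less than
    \<open>\<delta>2\<close>, which bounds the gap.\<close>
  define \<delta> where "\<delta> = min \<delta>1 (\<delta>2 / 2)"
  have "\<exists>j. (\<Sum>i<k. u i * (\<Sum>\<beta>\<in>degs k. C j \<beta> * monomial UNIV \<beta> (($) (p i)))) \<noteq> 0"
    if inj: "inj_on p {..<k}" and p: "p ` {..<k} \<subseteq> ball q \<delta>" and u: "u 0 = 1" for p u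
  proof (rule ccontr)
    assume "\<not> ?thesis"
    moreover have "(\<Sum>i<k. u i * (\<Sum>\<beta>\<in>degs k. C j \<beta> * monomial UNIV \<beta> (($) (p i))))
        = (\<Sum>\<beta>\<in>degs k. C j \<beta> * (\<Sum>i<k. u i * monomial UNIV \<beta> (($) (p i))))" for j
      unfolding sum_distrib_left by (subst sum.swap) (simp only: mult.left_commute)
    ultimately have dep: "(\<Sum>\<beta>\<in>degs k. C j \<beta> * (\<Sum>i<k. u i * monomial UNIV \<beta> (($) (p i)))) = 0" for j
      by simp
    \<comment> \<open>The pair \<open>(s, t)\<close> depends on the points and weights, which is why
      all pairs were treated at once.\<close>
    obtain s where s: "s \<in> degs k" "(\<Sum>i<k. u i * monomial UNIV s (($) (p i))) \<noteq> 0"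
      using exists_nonzero_evaluation[OF inj, of u] k u by fastforce
    have "p 1 \<noteq> p 0"
      using inj_on_eq_iff[OF inj, of 1 0] k by simp
    then obtain t where t: "p 1 $ t \<noteq> p 0 $ t" by (auto simp: vec_eq_iff)
    have near: "dist q (p 0) < \<delta>" "dist q (p 1) < \<delta>"
      using p k by (auto simp: image_subset_iff)
    then have "dist (p 1) (p 0) < \<delta>2"
      using dist_triangle_half_r[of q "p 1" \<delta>2 "p 0"] by (simp add: \<delta>_def)
    then have "norm (p 1 $ t - p 0 $ t) < \<delta>2"
      using dist_vec_nth_le[of "p 1" t "p 0"] by (simp add: dist_norm)
    then have in_U: "Z (p 0, p 1 $ t - p 0 $ t) \<in> U"
      using \<delta> near AB(5) by (auto simp: \<delta>_def subset_eq)
    have "Z (p 0, p 1 $ t - p 0 $ t) Gap \<noteq> 0"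
      using t by (simp add: Z_def)
    moreover have "dependency k s t (Z (p 0, p 1 $ t - p 0 $ t))"
      unfolding dependency_def using s(2) dep u
      by (intro exI[of _ p] exI[of _ u]) (simp add: Z_def C_def)
    ultimately show False
      using U[of "(s, t)", OF _ in_U] rel[of "(s, t)" "Z (p 0, p 1 $ t - p 0 $ t)"] s(1) by simp
  qed
  moreover have "\<delta> > 0" using \<delta> by (simp add: \<delta>_def)
  ultimately show ?thesis
    by (intro exI[of _ C] exI[of _ q] exI[of _ \<delta>] conjI allI impI)
qed

section \<open>From a small ball to the whole space\<close>

lemma exists_inj_continuous_into_ball:
  fixes q :: "'v::real_normed_vector"
  assumes "\<delta> > 0"
  shows "\<exists>h :: 'v \<Rightarrow> 'v. continuous_on UNIV h \<and> inj h \<and> range h \<subseteq> ball q \<delta>"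
proof (intro exI conjI)
  define h where "h x = q + (\<delta> / (1 + norm x)) *\<^sub>R x" for x :: 'v
  have pos: "1 + norm x > 0" for x :: 'v
    by (simp add: add_pos_nonneg)
  then have ne: "1 + norm x \<noteq> 0" for x :: 'v
    by (metis less_irrefl)
  show "continuous_on UNIV h"
    unfolding h_def using ne by (intro continuous_intros) auto
  show "range h \<subseteq> ball q \<delta>"
    using assms pos by (auto simp: h_def dist_norm divide_simps mult_less_cancel_left)
  show "inj h"
  proof (rule injI)
    fix x y assume "h x = h y"
    then have eq: "(\<delta> / (1 + norm x)) *\<^sub>R x = (\<delta> / (1 + norm y)) *\<^sub>R y"
      by (simp add: h_def)
    \<comment> \<open>Since r / (1 + r) is injective for nonnegative r, equal images come from
      vectors of equal norm, and then the scaling factors agree.\<close>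
    from arg_cong[OF this, of norm] have "\<delta> * (norm x / (1 + norm x)) = \<delta> * (norm y / (1 + norm y))"
      using assms pos by (simp add: abs_of_pos)
    then have "norm x / (1 + norm x) = norm y / (1 + norm y)"
      using assms by (simp only: mult_cancel_left) auto
    then have "norm x = norm y"
      using ne[of x] ne[of y] by (simp add: frac_eq_eq algebra_simps)
    then show "x = y" using eq assms ne[of y] by simp
  qed
qed

text \<open>Lets a point of nonzero weight receive the index 0, where weights are normalised to
  1.\<close>

lemma bij_betw_lessThan_startE:
  assumes "finite S" "x \<in> S"
  obtains h :: "nat \<Rightarrow> 'a" where "bij_betw h {..<card S} S" "h 0 = x"
proof -
  obtain xs where xs: "set xs = S - {x}" "distinct xs"
    using finite_distinct_list[of "S - {x}"] assms by auto
  then have "distinct (x # xs)" "set (x # xs) = S" using assms by auto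
  moreover from this have "length (x # xs) = card S" by (metis distinct_card)
  ultimately have "bij_betw ((!) (x # xs)) {..<card S} S"
    by (intro bij_betw_nth) auto
  then show thesis by (rule that) simp
qed

text \<open>Weights indexed by \<open>S\<close> handle both claims: a collision
  \<open>f x = f y\<close> would be a relation with weights 1 and -1, and once \<open>f\<close> is
  injective, weights on the image pull back to \<open>S\<close>.\<close>

lemma inj_on_independent_image:
  fixes f :: "'b \<Rightarrow> 'a::field ^ 'n"
  assumes "finite S" and zero: "\<And>u x. (\<Sum>x\<in>S. u x *s f x) = 0 \<Longrightarrow> x \<in> S \<Longrightarrow> u x = 0"
  shows "inj_on f S \<and> vec.independent (f ` S)"
proof
  show inj: "inj_on f S"
  proof (rule inj_onI, rule ccontr)
    fix x y assume xy: "x \<in> S" "y \<in> S" "f x = f y" "x \<noteq> y"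
    define u :: "'b \<Rightarrow> 'a" where "u = (\<lambda>v. if v = x then 1 else if v = y then - 1 else 0)"
    have "(\<Sum>v\<in>S. u v *s f v) = (\<Sum>v\<in>S. (if v = x then f x else 0) + (if v = y then - f y else 0))"
      using xy by (intro sum.cong) (auto simp: u_def)
    also have "\<dots> = 0" using xy \<open>finite S\<close> by (simp add: sum.distrib)
    finally show False using zero[of u x] xy by (simp add: u_def)
  qed
  show "vec.independent (f ` S)"
  proof (rule vec.independent_if_scalars_zero)
    fix u v assume "(\<Sum>v\<in>f ` S. u v *s v) = 0" "v \<in> f ` S"
    then show "u v = 0"
      using zero[of "u \<circ> f"] by (auto simp: sum.reindex[OF inj])
  qed (simp add: \<open>finite S\<close>)
qed

text \<open>The injection \<open>h\<close> keeps distinct points distinct, so regularity on the ball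
  suffices. The general field covers the real and the complex case together.\<close>

lemma exists_regular_map:
  assumes k: "k \<ge> 2" and card: "CARD('n::finite) = (CARD('m::finite) + 1) * (k - 1)"
  shows "\<exists>f :: 'a::real_normed_field ^ 'm \<Rightarrow> 'a ^ 'n. continuous_on UNIV f \<and>
    (\<forall>S. finite S \<and> card S = k \<longrightarrow> inj_on f S \<and> vec.independent (f ` S))"
proof -
  obtain C :: "'n \<Rightarrow> ('m \<Rightarrow> nat) \<Rightarrow> 'a" and q :: "'a ^ 'm" and \<delta> where "\<delta> > 0"
    and reg: "\<And>p u. inj_on p {..<k} \<Longrightarrow> p ` {..<k} \<subseteq> ball q \<delta> \<Longrightarrow> u 0 = 1 \<Longrightarrow>
      \<exists>j. (\<Sum>i<k. u i * (\<Sum>\<beta>\<in>degs k. C j \<beta> * monomial UNIV \<beta> (($) (p i)))) \<noteq> 0"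
    using exists_locally_regular_polynomial[OF assms, where 'a = 'a] by blast
  obtain h :: "'a ^ 'm \<Rightarrow> 'a ^ 'm" where h: "continuous_on UNIV h" "inj h" "range h \<subseteq> ball q \<delta>"
    using exists_inj_continuous_into_ball[OF \<open>\<delta> > 0\<close>] by blast
  define f :: "'a ^ 'm \<Rightarrow> 'a ^ 'n" where
    "f x = (\<chi> j. \<Sum>\<beta>\<in>degs k. C j \<beta> * monomial UNIV \<beta> (($) (h x)))" for x
  have "continuous_on UNIV f"
    unfolding f_def monomial_def using h(1) by (intro continuous_intros)
  moreover have "inj_on f S \<and> vec.independent (f ` S)" if "finite S" "card S = k" for S
  proof (rule inj_on_independent_image[OF \<open>finite S\<close>], rule ccontr)
    fix u x assume dep: "(\<Sum>x\<in>S. u x *s f x) = 0" and "x \<in> S" "u x \<noteq> 0"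
    obtain e where e: "bij_betw e {..<k} S" "e 0 = x"
      using bij_betw_lessThan_startE[OF \<open>finite S\<close> \<open>x \<in> S\<close>] \<open>card S = k\<close> by metis
    \<comment> \<open>Division by \<open>u x\<close> gives the point with index 0 the weight 1 that
      \<open>reg\<close> asks for.\<close>
    have "(\<Sum>i<k. u (e i) / u x * (\<Sum>\<beta>\<in>degs k. C j \<beta> * monomial UNIV \<beta> (($) (h (e i))))) = 0" for j
    proof -
      have "(\<Sum>i<k. u (e i) / u x * (\<Sum>\<beta>\<in>degs k. C j \<beta> * monomial UNIV \<beta> (($) (h (e i)))))
          = (\<Sum>v\<in>S. u v / u x * f v $ j)"
        by (simp add: f_def flip: sum.reindex_bij_betw[OF e(1)])
      also have "\<dots> = (\<Sum>v\<in>S. u v *s f v) $ j / u x"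
        by (simp add: sum_divide_distrib)
      finally show ?thesis using dep by simp
    qed
    moreover have "inj_on (\<lambda>i. h (e i)) {..<k}"
      using e(1) h(2) by (auto simp: inj_on_def bij_betw_def)
    ultimately show False
      using reg[of "\<lambda>i. h (e i)" "\<lambda>i. u (e i) / u x"] h(3) e(2) \<open>u x \<noteq> 0\<close> by auto
  qed
  ultimately show ?thesis by blast
qed

theorem theorem1p2:
  fixes k :: nat
  assumes "k \<ge> 2"
    and "CARD('n::finite) = (CARD('m::finite) + 1) * (k - 1)"
  shows "(\<exists>f :: real^'m \<Rightarrow> real^'n. continuous_on UNIV f \<and> k_regular_real k f)
       \<and> (\<exists>g :: complex^'m \<Rightarrow> complex^'n. continuous_on UNIV g \<and> k_regular_complex k g)"
  unfolding k_regular_real_def k_regular_complex_def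
  by (intro conjI exists_regular_map assms)

end
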